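(* Let $p=p_1p_2\cdots p_k$ ($k\ge 1$) be any pattern with no isolated variables. Then Player 1 has a strategy in the $429$-ary sequence game which ensures that the infinite sequence resulting from game-play does not contain a word (finite string of consecutive terms) which matches $p$ under a partition into blocks $B_1,\dots,B_k$ all of lengths $|B_i|\ge 2$.
   Context: The $c$-ary sequence game: two players alternately choose symbols from a fixed set of $c$ symbols, forming an unending sequence $\alpha_1\alpha_2\alpha_3\dots$. Player 1 chooses $\alpha_1,\alpha_3,\alpha_5,\dots$ and Player 2 chooses $\alpha_2,\alpha_4,\alpha_6,\dots$; each choice is made with full knowledge of all previous choices. A strategy for Player 1 is a function assigning to each finite history ending just before a move of Player 1 the symbol he plays. It ensures a property if every infinite sequence resulting from play in which Player 1 follows the strategy (with arbitrary moves by Player 2) has that property. A pattern is a finite nonempty string $p_1p_2\cdots p_k$ of variables. A variable of a pattern is isolated if it occurs exactly once in the pattern. A word matches the pattern $p_1\cdots p_k$ under a partition into consecutive blocks $B_1,B_2,\dots,B_k$ (so the word is the concatenation $B_1B_2\cdots B_k$) if $p_i=p_j$ implies $B_i=B_j$ for all $1\le i,j\le k$. $|B_i|$ denotes the length of $B_i$. *)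

theory Defs
  imports Main
begin

text \<open>
  An infinite sequence is a function on \<^typ>\<open>nat\<close>, indexed from 0: the term
  \<open>\<alpha> n\<close> is $\alpha_{n+1}$ of the usual numbering. Hence Player 1, who chooses
  $\alpha_1, \alpha_3, \ldots$, moves at the even indices, i.e. after histories of even length.
  The $c$-ary sequence game is the game over a symbol set \<open>A\<close> with \<open>card A = c\<close>.
\<close>

definition player1_strategy :: "'a set \<Rightarrow> ('a list \<Rightarrow> 'a) \<Rightarrow> bool" where
  "player1_strategy A \<sigma> \<longleftrightarrow> (\<forall>h \<in> lists A. even (length h) \<longrightarrow> \<sigma> h \<in> A)"

definition player1_follows :: "'a set \<Rightarrow> ('a list \<Rightarrow> 'a) \<Rightarrow> (nat \<Rightarrow> 'a) \<Rightarrow> bool" where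
  "player1_follows A \<sigma> \<alpha> \<longleftrightarrow>
     (\<forall>n. \<alpha> n \<in> A) \<and> (\<forall>n. even n \<longrightarrow> \<alpha> n = \<sigma> (map \<alpha> [0..<n]))"

definition ensures :: "'a set \<Rightarrow> ('a list \<Rightarrow> 'a) \<Rightarrow> ((nat \<Rightarrow> 'a) \<Rightarrow> bool) \<Rightarrow> bool" where
  "ensures A \<sigma> P \<longleftrightarrow> (\<forall>\<alpha>. player1_follows A \<sigma> \<alpha> \<longrightarrow> P \<alpha>)"

definition contains_word :: "(nat \<Rightarrow> 'a) \<Rightarrow> 'a list \<Rightarrow> bool" where
  "contains_word \<alpha> w \<longleftrightarrow> (\<exists>i. w = map \<alpha> [i..<i + length w])"

definition isolated :: "'v list \<Rightarrow> 'v \<Rightarrow> bool" where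
  "isolated p x \<longleftrightarrow> count_list p x = 1"

text \<open>
  Distinct variables may be assigned equal blocks.
\<close>

definition matches_under :: "'a list \<Rightarrow> 'v list \<Rightarrow> 'a list list \<Rightarrow> bool" where
  "matches_under w p Bs \<longleftrightarrow>
     length Bs = length p \<and> w = concat Bs \<and>
     (\<forall>i < length p. \<forall>j < length p. p ! i = p ! j \<longrightarrow> Bs ! i = Bs ! j)"

end

theory Submission
  imports Defs Complex_Main "HOL-Library.FuncSet"
begin

text \<open>
  The game is closed for Player 1, so it is enough to show that no fixed strategy \<open>\<tau>\<close> of
  Player 2 forces an occurrence of the pattern within finitely many rounds. Against \<open>\<tau>\<close>,
  the number \<open>g n\<close> of pattern-avoiding plays of \<open>n\<close> rounds grows at least by the factor
  \<open>\<beta> = c / 2\<close> per round, where \<open>c \<ge> 28\<close> is the number of symbols. Indeed, among the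
  \<open>c * g n\<close> extensions of the avoiding plays by one round, those that create an occurrence
  with given end and block lengths, and with \<open>F\<close> moves of Player 1 in the first blocks of the
  variables and \<open>T\<close> moves of Player 1 in total, number at most
  \<open>c ^ F * g (n + 1 - T) \<le> c ^ F * \<beta> ^ (1 - T) * g n\<close>. Blocks have length at least 2 and
  every variable occurs twice, so these bounds sum over all block lengths and both possible
  ends to at most \<open>\<beta> * g n\<close>.
\<close>

section \<open>Closed games\<close>

definition follows2 :: "'a set \<Rightarrow> ('a list \<Rightarrow> 'a) \<Rightarrow> 'a list \<Rightarrow> bool" where
  "follows2 A \<tau> h \<longleftrightarrow> set h \<subseteq> A \<and> (\<forall>m<length h. odd m \<longrightarrow> h ! m = \<tau> (take m h))"

text \<open>The value of the game with \<open>n\<close> rounds left. Only the final history is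
  tested; for a prefix-closed \<open>good\<close> this covers all earlier ones.\<close>

primrec survives :: "'a set \<Rightarrow> ('a list \<Rightarrow> bool) \<Rightarrow> nat \<Rightarrow> 'a list \<Rightarrow> bool" where
  "survives A good 0 h \<longleftrightarrow> good h"
| "survives A good (Suc n) h \<longleftrightarrow> (\<exists>a\<in>A. \<forall>b\<in>A. survives A good n (h @ [a, b]))"

lemma survives_Suc_imp:
  assumes "A \<noteq> {}" and prefix: "\<And>g h. good (g @ h) \<Longrightarrow> good g"
  shows "survives A good (Suc n) h \<Longrightarrow> survives A good n h"
proof (induction n arbitrary: h)
  case 0
  then obtain a b where "survives A good 0 (h @ [a, b])" using \<open>A \<noteq> {}\<close> by auto
  then have "good (h @ [a, b])" by simp
  then have "good h" by (rule prefix)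
  then show ?case by simp
next
  case (Suc n)
  from Suc.prems obtain a where "a \<in> A" and a: "\<forall>b\<in>A. survives A good (Suc n) (h @ [a, b])"
    by (subst (asm) survives.simps(2)) blast
  then have "\<forall>b\<in>A. survives A good n (h @ [a, b])" using Suc.IH by blast
  then show ?case unfolding survives.simps(2)[of A good n] using \<open>a \<in> A\<close> by blast
qed

lemma survives_antimono:
  assumes "A \<noteq> {}" and "\<And>g h. good (g @ h) \<Longrightarrow> good g" and "m \<le> n"
  shows "survives A good n h \<Longrightarrow> survives A good m h"
  using \<open>m \<le> n\<close>
proof (induction n rule: dec_induct)
  case (step n)
  then show ?case using survives_Suc_imp[OF assms(1), of good n h] assms(2) by blast
qed

text \<open>Compactness over the finitely many moves: if each \<open>a\<close> could be beaten
  within \<open>f a\<close> rounds, the maximum of these numbers would serve for all moves at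
  once.\<close>

lemma survives_forever_step:
  assumes "finite A" "A \<noteq> {}" and prefix: "\<And>g h. good (g @ h) \<Longrightarrow> good g"
    and "\<And>n. survives A good n h"
  shows "\<exists>a\<in>A. \<forall>b\<in>A. \<forall>n. survives A good n (h @ [a, b])"
proof (rule ccontr)
  assume "\<not> ?thesis"
  then have "\<forall>a\<in>A. \<exists>n. \<exists>b\<in>A. \<not> survives A good n (h @ [a, b])" by blast
  then obtain f where f: "\<And>a. a \<in> A \<Longrightarrow> \<exists>b\<in>A. \<not> survives A good (f a) (h @ [a, b])"
    by metis
  have "survives A good (Suc (Max (f ` A))) h" by fact
  then obtain a where a: "a \<in> A" "\<And>b. b \<in> A \<Longrightarrow> survives A good (Max (f ` A)) (h @ [a, b])"
    by auto
  moreover have "f a \<le> Max (f ` A)" using a \<open>finite A\<close> by simp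
  ultimately show False
    using f[OF a(1)] survives_antimono[OF \<open>A \<noteq> {}\<close>, of good "f a" "Max (f ` A)"] prefix by blast
qed

text \<open>Determinacy of the game with \<open>n\<close> rounds: Player 2 always answers so that
  Player 1 still cannot survive the remaining rounds.\<close>

lemma not_survives_imp_refutation:
  assumes "A \<noteq> {}" and "\<not> survives A good n []"
  shows "\<exists>\<tau>. range \<tau> \<subseteq> A \<and> (\<forall>h. length h = 2 * n \<longrightarrow> follows2 A \<tau> h \<longrightarrow> \<not> good h)"
proof -
  \<comment> \<open>Here \<open>g\<close> is to end with a move of Player 1, so
    \<open>(length g + 1) div 2\<close> rounds are over once \<open>b\<close> is played.\<close>
  define Q where "Q g b \<longleftrightarrow> b \<in> A \<and> \<not> survives A good (n - (length g + 1) div 2) (g @ [b])" for g b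
  obtain a0 where "a0 \<in> A" using \<open>A \<noteq> {}\<close> by auto
  define \<tau> where "\<tau> g = (if \<exists>b. Q g b then SOME b. Q g b else a0)" for g
  have \<tau>: "Q g (\<tau> g)" if "Q g b" for g b
    using that unfolding \<tau>_def by (auto intro: someI)
  have "\<tau> g \<in> A" for g
  proof (cases "\<exists>b. Q g b")
    case True
    then show ?thesis using \<tau> Q_def by blast
  qed (use \<open>a0 \<in> A\<close> in \<open>simp add: \<tau>_def\<close>)
  moreover have "\<not> good h" if h: "length h = 2 * n" "follows2 A \<tau> h" for h
  proof -
    have "\<not> survives A good (n - j) (take (2 * j) h)" if "j \<le> n" for j
      using that
    proof (induction j)
      case 0
      then show ?case using assms by simp
    next
      case (Suc j)
      define g where "g = take (2 * j + 1) h"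
      have len: "length g = 2 * j + 1" using Suc.prems h g_def by simp
      have g: "g = take (2 * j) h @ [h ! (2 * j)]" "take (2 * Suc j) h = g @ [h ! (2 * j + 1)]"
        using Suc.prems h by (simp_all add: g_def take_Suc_conv_app_nth)
      have "n - j = Suc (n - Suc j)" using Suc.prems by simp
      moreover have "h ! (2 * j) \<in> A" using h Suc.prems by (auto simp: follows2_def subset_iff)
      ultimately obtain b where "b \<in> A" "\<not> survives A good (n - Suc j) (g @ [b])"
        using Suc.IH Suc.prems g by auto
      then have "Q g b" using len by (simp add: Q_def)
      then have "Q g (\<tau> g)" by (rule \<tau>)
      moreover have "h ! (2 * j + 1) = \<tau> g" using h Suc.prems by (auto simp: follows2_def g_def)
      ultimately show ?case using g len by (simp add: Q_def)
    qed
    from this[of n] show ?thesis using h by simp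
  qed
  ultimately show ?thesis by blast
qed

text \<open>Determinacy of closed games: by \<open>play\<close>, Player 2 wins no finite version, so
  the empty history survives any number of rounds, and Player 1 can preserve this property round by
  round.\<close>

lemma closed_game_strategy:
  assumes "finite A" "A \<noteq> {}" and prefix: "\<And>g h. good (g @ h) \<Longrightarrow> good g"
    and play: "\<And>\<tau> n. range \<tau> \<subseteq> A \<Longrightarrow> \<exists>h. length h = 2 * n \<and> follows2 A \<tau> h \<and> good h"
  shows "\<exists>\<sigma>. player1_strategy A \<sigma> \<and> ensures A \<sigma> (\<lambda>\<alpha>. \<forall>n. good (map \<alpha> [0..<n]))"
proof -
  define W where "W h \<longleftrightarrow> (\<forall>n. survives A good n h)" for h
  have W0: "W []"
  proof (rule ccontr)
    assume "\<not> W []"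
    then obtain n where "\<not> survives A good n []" by (auto simp: W_def)
    from not_survives_imp_refutation[OF \<open>A \<noteq> {}\<close> this] obtain \<tau>
      where "range \<tau> \<subseteq> A" "\<forall>h. length h = 2 * n \<longrightarrow> follows2 A \<tau> h \<longrightarrow> \<not> good h" by blast
    then show False using play by blast
  qed
  define R where "R h a \<longleftrightarrow> a \<in> A \<and> (\<forall>b\<in>A. W (h @ [a, b]))" for h a
  obtain a0 where "a0 \<in> A" using \<open>A \<noteq> {}\<close> by auto
  define \<sigma> where "\<sigma> h = (if W h then SOME a. R h a else a0)" for h
  have \<sigma>: "R h (\<sigma> h)" if "W h" for h
  proof -
    have "\<exists>a. R h a"
      using survives_forever_step[OF assms(1,2), of good h] prefix that unfolding W_def R_def by blast
    then show ?thesis using that by (auto simp: \<sigma>_def intro: someI_ex)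
  qed
  have "\<sigma> h \<in> A" for h
    using \<sigma>[of h] \<open>a0 \<in> A\<close> by (cases "W h") (auto simp: R_def \<sigma>_def)
  then have "player1_strategy A \<sigma>" by (simp add: player1_strategy_def)
  moreover have "good (map \<alpha> [0..<n])" if \<alpha>: "player1_follows A \<sigma> \<alpha>" for \<alpha> n
  proof -
    have W: "W (map \<alpha> [0..<2 * n])" for n
    proof (induction n)
      case (Suc n)
      have "\<alpha> (2 * n) = \<sigma> (map \<alpha> [0..<2 * n])" "\<alpha> (2 * n + 1) \<in> A"
        using \<alpha> by (auto simp: player1_follows_def)
      then show ?case using \<sigma>[OF Suc.IH] by (simp add: R_def)
    qed (simp add: W0)
    \<comment> \<open>The invariant speaks of full rounds only; a history of any length
      \<open>n\<close> is a prefix of one of length \<open>2 * n\<close>.\<close>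
    have "good (map \<alpha> [0..<2 * n])"
      using W[of n] survives.simps(1) unfolding W_def by metis
    moreover have "map \<alpha> [0..<2 * n] = map \<alpha> [0..<n] @ map \<alpha> [n..<2 * n]"
      using upt_add_eq_append[of 0 n n] by (simp add: mult_2)
    ultimately show ?thesis using prefix by metis
  qed
  ultimately show ?thesis unfolding ensures_def by blast
qed

section \<open>Occurrences of a pattern with prescribed block lengths\<close>

text \<open>The start of block \<open>i\<close> relative to the start of the occurrence; at
  \<open>length p\<close> it is the length of the whole word.\<close>

definition offset :: "('v \<Rightarrow> nat) \<Rightarrow> 'v list \<Rightarrow> nat \<Rightarrow> nat" where
  "offset L p i = (\<Sum>j<i. L (p ! j))"

text \<open>Taking a function as argument serves infinite sequences and, through \<open>(!)\<close>,
  finite histories alike.\<close>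

definition occurs_at :: "'v list \<Rightarrow> ('v \<Rightarrow> nat) \<Rightarrow> nat \<Rightarrow> (nat \<Rightarrow> 'a) \<Rightarrow> bool" where
  "occurs_at p L s f \<longleftrightarrow> (\<forall>i<length p. \<forall>j<length p. p ! i = p ! j \<longrightarrow>
     (\<forall>t<L (p ! i). f (s + offset L p i + t) = f (s + offset L p j + t)))"

definition avoiding :: "'v list \<Rightarrow> 'a list \<Rightarrow> bool" where
  "avoiding p h \<longleftrightarrow> (\<forall>s L. (\<forall>x\<in>set p. 2 \<le> L x) \<longrightarrow> s + offset L p (length p) \<le> length h \<longrightarrow>
     \<not> occurs_at p L s ((!) h))"

lemma offset_Suc [simp]: "offset L p (Suc i) = offset L p i + L (p ! i)"
  by (simp add: offset_def)

lemma offset_0 [simp]: "offset L p 0 = 0"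
  by (simp add: offset_def)

lemma offset_mono: "i \<le> j \<Longrightarrow> offset L p i \<le> offset L p j"
  unfolding offset_def by (rule sum_mono2) auto

lemma offset_block_le: "i < j \<Longrightarrow> offset L p i + L (p ! i) \<le> offset L p j"
  using offset_mono[of "Suc i" j L p] by simp

lemma offset_cong:
  assumes "\<And>x. x \<in> set p \<Longrightarrow> L x = L' x" "i \<le> length p"
  shows "offset L p i = offset L' p i"
  unfolding offset_def using assms by (intro sum.cong) auto

lemma offset_locate:
  "q < offset L p k \<Longrightarrow> \<exists>i<k. \<exists>t<L (p ! i). q = offset L p i + t"
proof (induction k)
  case (Suc k)
  show ?case
  proof (cases "q < offset L p k")
    case True
    then show ?thesis using Suc.IH less_Suc_eq by metis
  next
    case False
    then have "q - offset L p k < L (p ! k)" "q = offset L p k + (q - offset L p k)"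
      using Suc.prems by auto
    then show ?thesis by blast
  qed
qed simp

lemma occurs_at_cong:
  assumes "\<And>q. q < s + offset L p (length p) \<Longrightarrow> f q = g q"
  shows "occurs_at p L s f = occurs_at p L s g"
proof -
  have "f (s + offset L p i + t) = g (s + offset L p i + t)" if "i < length p" "t < L (p ! i)" for i t
    using assms offset_block_le[OF that(1), of L p] that by simp
  then show ?thesis unfolding occurs_at_def by simp
qed

lemma occurs_at_lengths_cong:
  assumes "\<And>x. x \<in> set p \<Longrightarrow> L x = L' x"
  shows "occurs_at p L s f = occurs_at p L' s f"
proof -
  have "offset L p i = offset L' p i" "L (p ! i) = L' (p ! i)" if "i < length p" for i
    using that assms offset_cong[of p L L' i] by auto
  then show ?thesis unfolding occurs_at_def by simp
qed

lemma avoiding_prefix: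
  assumes "avoiding p (g @ h)"
  shows "avoiding p g"
  unfolding avoiding_def
proof (intro allI impI)
  fix s and L :: "'a \<Rightarrow> nat"
  assume L: "\<forall>x\<in>set p. 2 \<le> L x" "s + offset L p (length p) \<le> length g"
  then have "\<not> occurs_at p L s ((!) (g @ h))" using assms by (simp add: avoiding_def)
  moreover have "occurs_at p L s ((!) (g @ h)) = occurs_at p L s ((!) g)"
    using L by (intro occurs_at_cong) (auto simp: nth_append)
  ultimately show "\<not> occurs_at p L s ((!) g)" by simp
qed

lemma avoiding_take: "avoiding p h \<Longrightarrow> avoiding p (take n h)"
  using avoiding_prefix[of p "take n h" "drop n h"] by simp

lemma nth_concat_offset:
  assumes "length Bs = length p" "\<And>i. i < length p \<Longrightarrow> length (Bs ! i) = L (p ! i)"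
    "i < length p" "t < L (p ! i)"
  shows "concat Bs ! (offset L p i + t) = Bs ! i ! t"
proof -
  have off: "length (concat (take j Bs)) = offset L p j" if "j \<le> length p" for j
    using that assms(1,2) by (induction j) (simp_all add: take_Suc_conv_app_nth)
  have "Bs = take i Bs @ Bs ! i # drop (Suc i) Bs"
    using assms(1,3) by (simp add: id_take_nth_drop)
  then have "concat Bs = concat (take i Bs) @ Bs ! i @ concat (drop (Suc i) Bs)"
    by (metis concat.simps(2) concat_append)
  then show ?thesis using off[of i] assms(2)[of i] assms(3,4) by (simp add: nth_append)
qed

text \<open>Equal variables carry equal blocks, so block lengths depend on the variable alone and
  can be read off at any of its positions.\<close>

lemma match_imp_occurs_at:
  assumes "matches_under w p Bs" "\<And>i. i < length p \<Longrightarrow> 2 \<le> length (Bs ! i)" "w = map \<alpha> [s..<s + length w]"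
  shows "\<exists>L. (\<forall>x\<in>set p. 2 \<le> L x) \<and> occurs_at p L s \<alpha>"
proof -
  have Bs: "length Bs = length p" "w = concat Bs"
    "\<And>i j. i < length p \<Longrightarrow> j < length p \<Longrightarrow> p ! i = p ! j \<Longrightarrow> Bs ! i = Bs ! j"
    using assms(1) unfolding matches_under_def by blast+
  define L where "L x = length (Bs ! (SOME i. i < length p \<and> p ! i = x))" for x
  have L: "length (Bs ! i) = L (p ! i)" if "i < length p" for i
  proof -
    define j where "j = (SOME j. j < length p \<and> p ! j = p ! i)"
    have "j < length p \<and> p ! j = p ! i"
      unfolding j_def by (rule someI[of _ i]) (rule conjI[OF that refl])
    then have "Bs ! j = Bs ! i" using Bs(3) that by blast
    then show ?thesis unfolding L_def j_def[symmetric] by (simp only:)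
  qed
  have len: "length w = offset L p (length p)"
    unfolding Bs(2) length_concat offset_def using Bs(1) L
    by (simp add: sum_list_sum_nth atLeast0LessThan)
  have at: "\<alpha> (s + offset L p i + t) = Bs ! i ! t" if "i < length p" "t < L (p ! i)" for i t
  proof -
    have "offset L p i + t < length w"
      using offset_block_le[OF that(1), of L p] that len by simp
    then have "w ! (offset L p i + t) = \<alpha> (s + offset L p i + t)"
      by (subst assms(3)) (simp add: add.assoc)
    then show ?thesis using nth_concat_offset[OF Bs(1) L that] Bs(2) by simp
  qed
  have "occurs_at p L s \<alpha>"
    unfolding occurs_at_def
  proof (intro allI impI)
    fix i j t
    assume ij: "i < length p" "j < length p" "p ! i = p ! j" and "t < L (p ! i)"
    then have "\<alpha> (s + offset L p i + t) = Bs ! i ! t" "\<alpha> (s + offset L p j + t) = Bs ! j ! t"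
      using at by metis+
    then show "\<alpha> (s + offset L p i + t) = \<alpha> (s + offset L p j + t)"
      using Bs(3)[OF ij] by (simp only:)
  qed
  moreover have "\<forall>x\<in>set p. 2 \<le> L x"
    using L assms(2) by (metis in_set_conv_nth)
  ultimately show ?thesis by blast
qed

text \<open>The first position is singled out because only there can a block bring new symbols;
  later blocks of the variable are copies.\<close>

lemma two_occurrences:
  assumes "\<not> isolated p x" "x \<in> set p"
  shows "\<exists>i j. i < j \<and> j < length p \<and> p ! i = x \<and> p ! j = x \<and> (\<forall>k<i. p ! k \<noteq> x)"
proof -
  define S where "S = {i. i < length p \<and> p ! i = x}"
  have "card S = count_list p x"
    unfolding S_def count_list_eq_length_filter length_filter_conv_card by (simp add: eq_commute)
  then have "card S \<noteq> 1" using assms(1) by (simp add: isolated_def)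
  moreover have "finite S" "S \<noteq> {}" using assms(2) by (auto simp: S_def in_set_conv_nth)
  ultimately have "\<exists>j\<in>S. j \<noteq> Min S"
    using is_singletonI'[of S] unfolding is_singleton_altdef by metis
  then obtain j where j: "j \<in> S" "j \<noteq> Min S" by blast
  define i where "i = Min S"
  have i: "i \<le> j" "i \<in> S" using j \<open>finite S\<close> \<open>S \<noteq> {}\<close> by (auto simp: i_def)
  have "p ! k \<noteq> x" if "k < i" for k
  proof
    assume "p ! k = x"
    then have "k \<in> S" using that i by (auto simp: S_def)
    then show False using that \<open>finite S\<close> unfolding i_def by (meson Min_le not_le)
  qed
  then have "i < j \<and> j < length p \<and> p ! i = x \<and> p ! j = x \<and> (\<forall>k<i. p ! k \<noteq> x)"
    using i j unfolding i_def[symmetric] by (simp add: S_def)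
  then show ?thesis by blast
qed

text \<open>This counts the moves of Player 1 in an interval of indices:
  \<open>(b + 1) div 2\<close> of them lie below \<open>b\<close>.\<close>

lemma card_even_interval:
  "a \<le> b \<Longrightarrow> card {q\<in>{a..<b}. even q} = (b + 1) div 2 - (a + 1) div (2::nat)"
proof (induction b rule: dec_induct)
  case (step b)
  have "{q\<in>{a..<Suc b}. even q} = (if even b then insert b {q\<in>{a..<b}. even q} else {q\<in>{a..<b}. even q})"
    using step.hyps by (auto simp: less_Suc_eq)
  then have "card {q\<in>{a..<Suc b}. even q} = (b + 1) div 2 - (a + 1) div 2 + (if even b then 1 else 0)"
    using step.IH by simp
  also have "\<dots> = (Suc b + 1) div 2 - (a + 1) div 2"
  proof -
    have "(a + 1) div 2 \<le> (b + 1) div 2" using step.hyps by (intro div_le_mono) simp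
    moreover have "(Suc b + 1) div 2 = (b + 1) div 2 + (if even b then 1 else 0)"
      by (cases "even b") (auto elim!: evenE oddE)
    ultimately show ?thesis by linarith
  qed
  finally show ?case .
qed simp

section \<open>Counting the plays against a fixed opponent\<close>

definition avoiding_plays :: "'a set \<Rightarrow> ('a list \<Rightarrow> 'a) \<Rightarrow> 'v list \<Rightarrow> nat \<Rightarrow> 'a list set" where
  "avoiding_plays A \<tau> p n = {h. length h = 2 * n \<and> follows2 A \<tau> h \<and> avoiding p h}"

definition extended_plays :: "'a set \<Rightarrow> ('a list \<Rightarrow> 'a) \<Rightarrow> 'v list \<Rightarrow> nat \<Rightarrow> 'a list set" where
  "extended_plays A \<tau> p n =
     {h. length h = 2 * n + 2 \<and> follows2 A \<tau> h \<and> avoiding p (take (2 * n) h)}"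

text \<open>\<open>e\<close> is the index just after the occurrence; the inequality keeps the
  subtraction that yields its start from truncating.\<close>

definition plays_with_occurrence ::
    "'a set \<Rightarrow> ('a list \<Rightarrow> 'a) \<Rightarrow> 'v list \<Rightarrow> nat \<Rightarrow> nat \<Rightarrow> ('v \<Rightarrow> nat) \<Rightarrow> 'a list set" where
  "plays_with_occurrence A \<tau> p n e L =
     {h \<in> extended_plays A \<tau> p n. offset L p (length p) \<le> e \<and>
        occurs_at p L (e - offset L p (length p)) ((!) h)}"

lemma finite_plays:
  assumes "finite A"
  shows "finite (avoiding_plays A \<tau> p n)" "finite (extended_plays A \<tau> p n)"
    "finite (plays_with_occurrence A \<tau> p n e L)"
proof -
  have fin: "finite {h. set h \<subseteq> A \<and> length h = k}" for k
    using assms by (rule finite_lists_length_eq)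
  show "finite (avoiding_plays A \<tau> p n)"
    by (rule finite_subset[OF _ fin[of "2 * n"]]) (auto simp: avoiding_plays_def follows2_def)
  show ext: "finite (extended_plays A \<tau> p n)"
    by (rule finite_subset[OF _ fin[of "2 * n + 2"]]) (auto simp: extended_plays_def follows2_def)
  show "finite (plays_with_occurrence A \<tau> p n e L)"
    by (rule finite_subset[OF _ ext]) (auto simp: plays_with_occurrence_def)
qed

lemma follows2_take: "follows2 A \<tau> h \<Longrightarrow> follows2 A \<tau> (take k h)"
  unfolding follows2_def by (auto dest: in_set_takeD simp: min_def)

text \<open>Player 1's next symbol is free and the reply is dictated by \<tau>, so pairs of an
  avoiding play and a symbol inject into the extended plays.\<close>

lemma card_extended_plays_ge:
  assumes "finite A" "range \<tau> \<subseteq> A"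
  shows "card A * card (avoiding_plays A \<tau> p n) \<le> card (extended_plays A \<tau> p n)"
proof -
  define ext where "ext = (\<lambda>(h, a). h @ [a, \<tau> (h @ [a])])"
  have "inj_on ext (avoiding_plays A \<tau> p n \<times> A)"
    by (auto simp: inj_on_def ext_def)
  moreover have "ext ` (avoiding_plays A \<tau> p n \<times> A) \<subseteq> extended_plays A \<tau> p n"
  proof clarify
    fix h a assume h: "h \<in> avoiding_plays A \<tau> p n" and "a \<in> A"
    define h' where "h' = h @ [a, \<tau> (h @ [a])]"
    have len: "length h = 2 * n" using h by (simp add: avoiding_plays_def)
    have "h' ! m = \<tau> (take m h')" if "m < length h'" "odd m" for m
    proof (cases "m < 2 * n")
      case True
      then show ?thesis using h that len
        by (auto simp: h'_def avoiding_plays_def follows2_def nth_append)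
    next
      case False
      then have "m = 2 * n + 1" using that len by (auto simp: h'_def less_Suc_eq)
      then show ?thesis using len by (simp add: h'_def nth_append)
    qed
    moreover have "set h' \<subseteq> A"
      using h \<open>a \<in> A\<close> assms(2) by (auto simp: h'_def avoiding_plays_def follows2_def)
    ultimately have "h' \<in> extended_plays A \<tau> p n"
      using h len by (simp add: extended_plays_def follows2_def avoiding_plays_def) (simp add: h'_def)
    then show "ext (h, a) \<in> extended_plays A \<tau> p n" by (simp add: ext_def h'_def)
  qed
  ultimately have "card (avoiding_plays A \<tau> p n \<times> A) \<le> card (extended_plays A \<tau> p n)"
    using finite_plays(2)[OF assms(1)] by (rule card_inj_on_le)
  then show ?thesis by (simp add: card_cartesian_product mult.commute)
qed

text \<open>
  A play is determined by its part before the occurrence together with Player 1's moves in the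
  first block of each variable: Player 2's moves follow \<open>\<tau>\<close>, and every other move of
  Player 1 repeats an earlier symbol.
\<close>

lemma card_plays_with_occurrence_le:
  fixes p :: "'v list"
  assumes "finite A"
    and first: "\<And>x. x \<in> set p \<Longrightarrow> first x < length p \<and> p ! first x = x \<and> (\<forall>k<first x. p ! k \<noteq> x)"
    and e: "e = s + offset L p (length p)" "e = 2 * n + 1 \<or> e = 2 * n + 2"
    and m: "m = (s + 1) div 2" "m \<le> n"
    and F: "F = (\<Union>x\<in>set p. {q\<in>{s + offset L p (first x)..<s + offset L p (first x) + L x}. even q})"
  shows "card (plays_with_occurrence A \<tau> p n e L) \<le> card (avoiding_plays A \<tau> p m) * card A ^ card F"
proof -
  define D where "D = plays_with_occurrence A \<tau> p n e L"
  \<comment> \<open>\<open>2 * m\<close> is \<open>s\<close> or \<open>s + 1\<close>, so the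
    recorded prefix covers all indices below \<open>s\<close> but no move of Player 1 from
    \<open>s\<close> on.\<close>
  define \<phi> where "\<phi> h = (take (2 * m) h, restrict ((!) h) F)" for h :: "'a list"
  have D: "length h = 2 * n + 2" "follows2 A \<tau> h" "avoiding p (take (2 * n) h)"
      "occurs_at p L s ((!) h)" if "h \<in> D" for h
    using that e(1) by (simp_all add: D_def plays_with_occurrence_def extended_plays_def)
  have "finite F" by (simp add: F)
  have F_lt: "q < 2 * n + 2" if q: "q \<in> F" for q
  proof -
    obtain x where x: "x \<in> set p" "q < s + offset L p (first x) + L x"
      using q unfolding F by auto
    then have "q < e"
      using first[OF x(1)] offset_block_le[of "first x" "length p" L p] e(1) by simp
    then show ?thesis using e(2) by auto
  qed
  have "inj_on \<phi> D"
  proof (rule inj_onI)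
    fix h h' assume h: "h \<in> D" "h' \<in> D" "\<phi> h = \<phi> h'"
    note Dh = D[OF h(1)] D[OF h(2)]
    have "h ! q = h' ! q" if "q < 2 * n + 2" for q
      using that
    proof (induction q rule: less_induct)
      case (less q)
      consider "q < 2 * m" | "odd q" | "even q" "2 * m \<le> q" by linarith
      then show ?case
      proof cases
        case 1
        have "take (2 * m) h ! q = take (2 * m) h' ! q" using h(3) by (simp add: \<phi>_def)
        then show ?thesis using 1 by simp
      next
        case 2
        have "take q h = take q h'"
          using less Dh(1) Dh(5) by (intro nth_equalityI) auto
        moreover have "h ! q = \<tau> (take q h)" "h' ! q = \<tau> (take q h')"
          using 2 less.prems Dh by (simp_all add: follows2_def)
        ultimately show ?thesis by simp
      next
        case 3
        \<comment> \<open>The last index is odd, so an even \<open>q\<close> lies before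
          \<open>e\<close> for either value of \<open>e\<close>.\<close>
        have "q \<noteq> 2 * n + 1" using 3 by auto
        then have "q < 2 * n + 1" using less.prems by simp
        then have "s \<le> q" "q < e" using e(2) 3 m(1) by auto
        then have "q - s < offset L p (length p)" using e(1) by simp
        then obtain i t where it: "i < length p" "t < L (p ! i)" "q - s = offset L p i + t"
          using offset_locate by blast
        \<comment> \<open>If the block of \<open>q\<close> is the first of its variable, \<phi>
          records the symbol; otherwise the same place in the first block is earlier and the
          induction hypothesis applies.\<close>
        define j where "j = first (p ! i)"
        have j: "j < length p" "p ! j = p ! i" "j \<le> i"
          using first[of "p ! i"] it(1) unfolding j_def by (auto simp: not_less[symmetric])
        have q: "q = s + offset L p i + t" using it(3) \<open>s \<le> q\<close> by simp
        show ?thesis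
        proof (cases "j = i")
          case True
          have "q \<in> F"
            unfolding F using it(1,2) True q 3(1) by (intro UN_I[of "p ! i"]) (auto simp: j_def)
          moreover have "restrict ((!) h) F q = restrict ((!) h') F q"
            using h(3) by (simp add: \<phi>_def)
          ultimately show ?thesis by simp
        next
          case False
          then have "offset L p j + L (p ! i) \<le> offset L p i"
            using offset_block_le[of j i L p] j by simp
          then have "s + offset L p j + t < q" using it(2) q by simp
          then have "h ! (s + offset L p j + t) = h' ! (s + offset L p j + t)"
            using less by simp
          moreover have "g ! q = g ! (s + offset L p j + t)" if "occurs_at p L s ((!) g)" for g :: "'a list"
            using that it(1,2) j(1,2) q unfolding occurs_at_def by metis
          ultimately show ?thesis using Dh(4,8) by metis
        qed
      qed
    qed
    then show "h = h'" using Dh(1,5) by (intro nth_equalityI) auto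
  qed
  moreover have "\<phi> ` D \<subseteq> avoiding_plays A \<tau> p m \<times> (F \<rightarrow>\<^sub>E A)"
  proof (rule image_subsetI)
    fix h assume h: "h \<in> D"
    have "take (2 * m) h = take (2 * m) (take (2 * n) h)" using m(2) by simp
    then have "avoiding p (take (2 * m) h)" using avoiding_take[OF D(3)[OF h]] by metis
    then have "take (2 * m) h \<in> avoiding_plays A \<tau> p m"
      using D[OF h] m(2) follows2_take by (auto simp: avoiding_plays_def)
    moreover have "restrict ((!) h) F \<in> F \<rightarrow>\<^sub>E A"
      using D(1,2)[OF h] F_lt by (auto simp: follows2_def subset_iff)
    ultimately show "\<phi> h \<in> avoiding_plays A \<tau> p m \<times> (F \<rightarrow>\<^sub>E A)" by (simp add: \<phi>_def)
  qed
  moreover have "finite (avoiding_plays A \<tau> p m \<times> (F \<rightarrow>\<^sub>E A))"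
    using \<open>finite F\<close> \<open>finite A\<close> finite_plays(1) by (intro finite_cartesian_product finite_PiE) auto
  ultimately have "card D \<le> card (avoiding_plays A \<tau> p m \<times> (F \<rightarrow>\<^sub>E A))"
    by (rule card_inj_on_le)
  then show ?thesis
    using \<open>finite F\<close> by (simp add: D_def card_cartesian_product card_PiE)
qed

text \<open>
  A variable with blocks of length \<open>l\<close> gives Player 1 at most \<open>(l + 1) div 2\<close> moves in its
  first block and at least \<open>l div 2\<close> in its last one. With \<open>c = 2 * \<beta>\<close> and \<open>\<beta> \<ge> 14\<close>
  it therefore contributes a factor of at most \<open>weight l\<close> to \<open>c ^ F / \<beta> ^ T\<close>.
\<close>

definition weight :: "nat \<Rightarrow> real" where
  "weight l = 2 ^ ((l + 1) div 2) / 14 ^ (l div 2)"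

lemma weight_nonneg: "0 \<le> weight l"
  by (simp add: weight_def)

text \<open>Lengths \<open>2 * k + 2\<close> and \<open>2 * k + 3\<close> together weigh
  \<open>3 / 7 ^ (k + 1)\<close>, a geometric series with full sum 1/2. The base 14 is tuned to this
  value: each of the two possible ends of an occurrence may cost half a factor \<beta>.\<close>

lemma sum_weight: "(\<Sum>l\<in>{2..<2 * k + 2}. weight l) = (1 - 1 / 7 ^ k) / 2"
proof (induction k)
  case (Suc k)
  have pow14: "(14::real) ^ k = 2 ^ k * 7 ^ k" by (simp flip: power_mult_distrib)
  have "{2..<2 * Suc k + 2} = insert (2 * k + 2) (insert (2 * k + 3) {2..<2 * k + 2})" by auto
  then have "(\<Sum>l\<in>{2..<2 * Suc k + 2}. weight l) = weight (2 * k + 2) + weight (2 * k + 3) + (1 - 1 / 7 ^ k) / 2"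
    using Suc.IH by simp
  also have "weight (2 * k + 2) = 1 / 7 ^ (k + 1)"
    by (simp add: weight_def pow14)
  also have "weight (2 * k + 3) = 2 / 7 ^ (k + 1)"
    by (simp add: weight_def pow14)
  finally show ?case by (simp add: field_simps)
qed simp

lemma sum_weight_le_half: "(\<Sum>l\<in>{2..<2 * k + 2}. weight l) \<le> 1 / 2"
  unfolding sum_weight by simp

text \<open>\<open>growth\<close> trades the count after \<open>m\<close> rounds for that after
  \<open>n\<close> rounds at the price \<open>\<beta> ^ (n - m)\<close>. The free moves
  \<open>F\<close> and the forced moves \<open>B\<close> are among the \<open>n + 1 - m\<close>
  moves of Player 1 in the occurrence, so the bound is one factor \<beta> times
  \<open>2 ^ card F / \<beta> ^ card B\<close>.\<close>

lemma card_plays_with_occurrence_le_weight: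
  fixes p :: "'v list"
  assumes "finite A" "28 \<le> card A" "\<nexists>x. isolated p x" "p \<noteq> []"
    and L: "\<And>x. x \<in> set p \<Longrightarrow> 2 \<le> L x"
    and e: "e = 2 * n + 1 \<or> e = 2 * n + 2"
    and growth: "\<And>m. m \<le> n \<Longrightarrow> real (card (avoiding_plays A \<tau> p m)) * (real (card A) / 2) ^ (n - m)
      \<le> real (card (avoiding_plays A \<tau> p n))"
  shows "real (card (plays_with_occurrence A \<tau> p n e L))
    \<le> real (card (avoiding_plays A \<tau> p n)) * (real (card A) / 2) * (\<Prod>x\<in>set p. weight (L x))"
proof (cases "offset L p (length p) \<le> e")
  case False
  then show ?thesis
    by (simp add: plays_with_occurrence_def prod_nonneg weight_nonneg)
next
  case True
  define s where "s = e - offset L p (length p)"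
  define m where "m = (s + 1) div 2"
  define \<beta> where "\<beta> = real (card A) / 2"
  have \<beta>: "14 \<le> \<beta>" "real (card A) = 2 * \<beta>" using assms(2) by (simp_all add: \<beta>_def)
  have es: "e = s + offset L p (length p)" using True by (simp add: s_def)
  \<comment> \<open>\<open>last x\<close> may be any later position of \<open>x\<close>, not
    necessarily the final one.\<close>
  obtain first last where fl: "\<And>x. x \<in> set p \<Longrightarrow> first x < last x \<and> last x < length p \<and>
      p ! first x = x \<and> p ! last x = x \<and> (\<forall>k<first x. p ! k \<noteq> x)"
    using two_occurrences[of p] assms(3) by metis
  define block where "block i = {q\<in>{s + offset L p i..<s + offset L p i + L (p ! i)}. even q}" for i
  have card_block: "card (block i) \<le> (L (p ! i) + 1) div 2" "L (p ! i) div 2 \<le> card (block i)" for i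
    unfolding block_def by (subst card_even_interval; simp; linarith)+
  have disj: "block i \<inter> block j = {}" if "i < j" for i j
    using offset_block_le[OF that, of L p] by (auto simp: block_def)
  define F where "F = (\<Union>x\<in>set p. block (first x))"
  define B where "B = (\<Union>x\<in>set p. block (last x))"
  have fin: "finite (block i)" for i by (simp add: block_def)
  have "card F \<le> (\<Sum>x\<in>set p. card (block (first x)))"
    unfolding F_def by (rule card_UN_le) simp
  also have "\<dots> \<le> (\<Sum>x\<in>set p. (L x + 1) div 2)"
    using card_block(1) fl by (intro sum_mono) metis
  finally have cF: "card F \<le> (\<Sum>x\<in>set p. (L x + 1) div 2)" .
  have disj': "block i \<inter> block j = {}" if "i \<noteq> j" for i j
    using that disj[of i j] disj[of j i] by (auto simp: neq_iff)
  \<comment> \<open>Bounding a union from below requires disjoint blocks, whereas subadditivity was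
    enough for \<open>F\<close>.\<close>
  have "(\<Sum>x\<in>set p. L x div 2) \<le> (\<Sum>x\<in>set p. card (block (last x)))"
    using card_block(2) fl by (intro sum_mono) metis
  also have "\<dots> = card B"
    unfolding B_def
  proof (rule card_UN_disjoint[symmetric])
    show "\<forall>x\<in>set p. \<forall>y\<in>set p. x \<noteq> y \<longrightarrow> block (last x) \<inter> block (last y) = {}"
      using fl disj' by metis
  qed (simp_all add: fin)
  finally have cB: "(\<Sum>x\<in>set p. L x div 2) \<le> card B" .
  have "F \<inter> B = {}"
  proof -
    have "first x \<noteq> last y" if "x \<in> set p" "y \<in> set p" for x y
      using fl[OF that(1)] fl[OF that(2)] by (metis less_irrefl)
    then have "block (first x) \<inter> block (last y) = {}" if "x \<in> set p" "y \<in> set p" for x y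
      using disj' that by blast
    then show ?thesis unfolding F_def B_def by blast
  qed
  moreover have "finite F" "finite B" by (simp_all add: F_def B_def fin)
  ultimately have "card F + card B = card (F \<union> B)" by (simp add: card_Un_disjoint)
  also have "\<dots> \<le> card {q\<in>{s..<e}. even q}"
  proof (rule card_mono)
    have "block i \<subseteq> {q\<in>{s..<e}. even q}" if "i < length p" for i
      using offset_block_le[OF that, of L p] es by (auto simp: block_def)
    moreover have "first x < length p" "last x < length p" if "x \<in> set p" for x
      using fl[OF that] by auto
    ultimately show "F \<union> B \<subseteq> {q\<in>{s..<e}. even q}"
      unfolding F_def B_def by blast
  qed simp
  also have "\<dots> = n + 1 - m"
  proof -
    \<comment> \<open>Both ends give the same count, since index \<open>2 * n + 1\<close> belongs to
      Player 2.\<close>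
    have "(e + 1) div 2 = n + 1" using e by auto
    then show ?thesis using card_even_interval[of s e] es by (simp add: m_def)
  qed
  finally have FB: "card F + card B \<le> n + 1 - m" .
  \<comment> \<open>A block of length at least 2 contains a move of Player 1, so \<open>B\<close> is
    nonempty, which forces \<open>m \<le> n\<close>.\<close>
  have "hd p \<in> set p" using assms(4) by simp
  then have "1 \<le> L (hd p) div 2" using L[of "hd p"] by simp
  also have "\<dots> \<le> (\<Sum>x\<in>set p. L x div 2)"
    using \<open>hd p \<in> set p\<close> by (intro member_le_sum) auto
  finally have "1 \<le> card B" using cB by simp
  then have "m \<le> n" using FB by simp
  have "F = (\<Union>x\<in>set p. {q\<in>{s + offset L p (first x)..<s + offset L p (first x) + L x}. even q})"
    unfolding F_def block_def using fl by (intro SUP_cong) auto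
  then have "card (plays_with_occurrence A \<tau> p n e L) \<le> card (avoiding_plays A \<tau> p m) * card A ^ card F"
    using fl by (intro card_plays_with_occurrence_le[OF assms(1) _ es e m_def \<open>m \<le> n\<close>, of first])
      (auto intro: less_trans)
  then have "real (card (plays_with_occurrence A \<tau> p n e L))
      \<le> real (card (avoiding_plays A \<tau> p m)) * (2 * \<beta>) ^ card F"
    unfolding \<beta>(2)[symmetric] by (metis of_nat_le_iff of_nat_mult of_nat_power)
  \<comment> \<open>Multiplying and dividing by \<open>\<beta> ^ card B\<close> produces the
    exponent \<open>card F + card B\<close>, which \<open>FB\<close> controls.\<close>
  also have "\<dots> = real (card (avoiding_plays A \<tau> p m)) * \<beta> ^ card F * \<beta> ^ card B * 2 ^ card F / \<beta> ^ card B"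
    using \<beta>(1) by (simp add: power_mult_distrib)
  also have "\<dots> \<le> real (card (avoiding_plays A \<tau> p m)) * (\<beta> ^ (n - m) * \<beta>) * 2 ^ card F / \<beta> ^ card B"
  proof -
    have "\<beta> ^ (card F + card B) \<le> \<beta> ^ Suc (n - m)"
      using FB \<open>m \<le> n\<close> \<beta>(1) by (intro power_increasing) auto
    then have "\<beta> ^ card F * \<beta> ^ card B \<le> \<beta> ^ (n - m) * \<beta>" by (simp add: power_add mult.commute)
    then show ?thesis
      unfolding mult.assoc[of _ "\<beta> ^ card F"] using \<beta>(1)
      by (intro divide_right_mono mult_right_mono mult_left_mono) auto
  qed
  also have "\<dots> \<le> real (card (avoiding_plays A \<tau> p n)) * \<beta> * 2 ^ card F / \<beta> ^ card B"
    unfolding mult.assoc[of _ "\<beta> ^ (n - m)", symmetric]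
    using growth[OF \<open>m \<le> n\<close>] \<beta>(1) unfolding \<beta>_def[symmetric]
    by (intro divide_right_mono mult_right_mono) (simp_all add: mult.assoc)
  also have "\<dots> = real (card (avoiding_plays A \<tau> p n)) * \<beta> * (2 ^ card F / \<beta> ^ card B)" by simp
  also have "\<dots> \<le> real (card (avoiding_plays A \<tau> p n)) * \<beta> * (\<Prod>x\<in>set p. weight (L x))"
  proof (rule mult_left_mono)
    have "2 ^ card F / \<beta> ^ card B \<le> 2 ^ (\<Sum>x\<in>set p. (L x + 1) div 2) / 14 ^ (\<Sum>x\<in>set p. L x div 2)"
    proof (rule frac_le)
      have "(14::real) ^ (\<Sum>x\<in>set p. L x div 2) \<le> 14 ^ card B"
        using cB by (intro power_increasing) auto
      also have "\<dots> \<le> \<beta> ^ card B" using \<beta>(1) by (intro power_mono) auto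
      finally show "(14::real) ^ (\<Sum>x\<in>set p. L x div 2) \<le> \<beta> ^ card B" .
    qed (use cF in \<open>auto intro: power_increasing\<close>)
    also have "\<dots> = (\<Prod>x\<in>set p. weight (L x))"
      by (simp add: weight_def power_sum prod_dividef)
    finally show "2 ^ card F / \<beta> ^ card B \<le> (\<Prod>x\<in>set p. weight (L x))" .
  qed (use \<beta>(1) in auto)
  finally show ?thesis by (simp add: \<beta>_def)
qed

section \<open>Growth of the number of avoiding plays\<close>

lemma extended_plays_subset:
  fixes p :: "'v list"
  shows "extended_plays A \<tau> p n \<subseteq> avoiding_plays A \<tau> p (Suc n) \<union>
    (\<Union>e\<in>{2 * n + 1, 2 * n + 2}. \<Union>L\<in>set p \<rightarrow>\<^sub>E {2..<2 * (n + 1) + 2}. plays_with_occurrence A \<tau> p n e L)"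
proof
  fix h assume h: "h \<in> extended_plays A \<tau> p n"
  then have len: "length h = 2 * n + 2" by (simp add: extended_plays_def)
  show "h \<in> avoiding_plays A \<tau> p (Suc n) \<union>
    (\<Union>e\<in>{2 * n + 1, 2 * n + 2}. \<Union>L\<in>set p \<rightarrow>\<^sub>E {2..<2 * (n + 1) + 2}. plays_with_occurrence A \<tau> p n e L)"
  proof (cases "avoiding p h")
    case True
    then show ?thesis using h by (simp add: extended_plays_def avoiding_plays_def)
  next
    case False
    then obtain s L0 where L0: "\<forall>x\<in>set p. 2 \<le> L0 x" "s + offset L0 p (length p) \<le> 2 * n + 2"
        "occurs_at p L0 s ((!) h)"
      using len unfolding avoiding_def by auto
    \<comment> \<open>Restriction makes the lengths an extensional function, so that they range over
      a finite set.\<close>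
    define L where "L = restrict L0 (set p)"
    define e where "e = s + offset L p (length p)"
    have L_eq: "L x = L0 x" if "x \<in> set p" for x using that by (simp add: L_def)
    have off: "offset L p (length p) = offset L0 p (length p)"
      using offset_cong[of p L L0 "length p"] L_eq by simp
    have L: "occurs_at p L s ((!) h)" "e \<le> 2 * n + 2"
      using L0 occurs_at_lengths_cong[of p L L0] L_eq off by (auto simp: e_def)
    \<comment> \<open>The first \<open>2 * n\<close> symbols avoid \<open>p\<close>, so the
      occurrence must end within the new round.\<close>
    have "\<not> e \<le> 2 * n"
    proof
      assume "e \<le> 2 * n"
      then have "occurs_at p L s ((!) (take (2 * n) h)) = occurs_at p L s ((!) h)"
        by (intro occurs_at_cong) (simp add: e_def)
      moreover have "avoiding p (take (2 * n) h)" using h by (simp add: extended_plays_def)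
      moreover have "\<forall>x\<in>set p. 2 \<le> L x" using L0(1) L_eq by simp
      ultimately show False
        using L(1) len \<open>e \<le> 2 * n\<close> by (simp add: avoiding_def e_def)
    qed
    then have "e \<in> {2 * n + 1, 2 * n + 2}" using L(2) by auto
    moreover have "L \<in> set p \<rightarrow>\<^sub>E {2..<2 * (n + 1) + 2}"
    proof (rule PiE_I)
      fix x assume "x \<in> set p"
      then obtain i where "i < length p" "p ! i = x" by (auto simp: in_set_conv_nth)
      then have "L x \<le> offset L p (length p)" using offset_block_le[of i "length p" L p] by simp
      then show "L x \<in> {2..<2 * (n + 1) + 2}"
        using L(2) L0(1) L_eq \<open>x \<in> set p\<close> by (simp add: e_def)
    qed (simp add: L_def)
    moreover have "h \<in> plays_with_occurrence A \<tau> p n e L"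
      using h L by (simp add: plays_with_occurrence_def e_def)
    ultimately show ?thesis by blast
  qed
qed

text \<open>The induction is strong because the loss in one round is bounded through the growth in
  all earlier rounds. Of at least \<open>2 * \<beta> * g n\<close> extended plays, at most
  \<open>\<beta> * g n\<close> are lost.\<close>

lemma card_avoiding_plays_Suc:
  fixes p :: "'v list"
  assumes "finite A" "28 \<le> card A" "range \<tau> \<subseteq> A" "\<nexists>x. isolated p x" "p \<noteq> []"
  shows "real (card (avoiding_plays A \<tau> p n)) * (real (card A) / 2)
    \<le> real (card (avoiding_plays A \<tau> p (Suc n)))"
proof (induction n rule: less_induct)
  case (less n)
  define g where "g k = real (card (avoiding_plays A \<tau> p k))" for k
  define \<beta> where "\<beta> = real (card A) / 2"
  define Ls where "Ls = set p \<rightarrow>\<^sub>E {2..<2 * (n + 1) + 2}"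
  let ?D = "\<lambda>e L. plays_with_occurrence A \<tau> p n e L"
  have "0 \<le> \<beta>" by (simp add: \<beta>_def)
  have "finite Ls" by (simp add: Ls_def finite_PiE)
  have growth: "g m * \<beta> ^ (n - m) \<le> g n" if "m \<le> n" for m
  proof -
    have "g m * \<beta> ^ (k - m) \<le> g k" if "m \<le> k" "k \<le> n" for k
      using that
    proof (induction k rule: dec_induct)
      case (step k)
      have "g m * \<beta> ^ (Suc k - m) = g m * \<beta> ^ (k - m) * \<beta>"
        using step.hyps by (simp add: Suc_diff_le)
      also have "\<dots> \<le> g k * \<beta>" using step \<open>0 \<le> \<beta>\<close> by (intro mult_right_mono) auto
      also have "\<dots> \<le> g (Suc k)" using less[of k] step.prems by (simp add: g_def \<beta>_def)
      finally show ?case .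
    qed simp
    then show ?thesis using that by simp
  qed
  have D_sum: "(\<Sum>L\<in>Ls. real (card (?D e L))) \<le> g n * \<beta> / 2" if "e \<in> {2 * n + 1, 2 * n + 2}" for e
  proof -
    have "(\<Sum>L\<in>Ls. real (card (?D e L))) \<le> (\<Sum>L\<in>Ls. g n * \<beta> * (\<Prod>x\<in>set p. weight (L x)))"
    proof (rule sum_mono)
      fix L assume "L \<in> Ls"
      then have "2 \<le> L x" if "x \<in> set p" for x
        using that by (auto simp: Ls_def dest!: PiE_mem)
      then show "real (card (?D e L)) \<le> g n * \<beta> * (\<Prod>x\<in>set p. weight (L x))"
        unfolding g_def \<beta>_def using \<open>e \<in> _\<close> assms growth
        by (intro card_plays_with_occurrence_le_weight) (auto simp: g_def \<beta>_def)
    qed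
    also have "\<dots> = g n * \<beta> * (\<Sum>L\<in>Ls. \<Prod>x\<in>set p. weight (L x))"
      by (simp add: sum_distrib_left)
    \<comment> \<open>Summing a product over all length assignments factors into one sum per
      variable.\<close>
    also have "(\<Sum>L\<in>Ls. \<Prod>x\<in>set p. weight (L x)) = (\<Prod>x\<in>set p. \<Sum>l\<in>{2..<2 * (n + 1) + 2}. weight l)"
      unfolding Ls_def by (rule prod_sum_PiE[symmetric]) auto
    also have "\<dots> = (\<Sum>l\<in>{2..<2 * (n + 1) + 2}. weight l) ^ card (set p)"
      by simp
    also have "\<dots> \<le> (1 / 2) ^ card (set p)"
      by (intro power_mono sum_weight_le_half sum_nonneg weight_nonneg)
    \<comment> \<open>A nonempty pattern has a variable, hence at least one factor 1/2.\<close>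
    also have "\<dots> \<le> (1 / 2) ^ 1"
      using assms(5) by (intro power_decreasing) (auto simp: Suc_le_eq card_gt_0_iff)
    finally show ?thesis using \<open>0 \<le> \<beta>\<close> by (simp add: mult_left_mono g_def)
  qed
  have "card A * card (avoiding_plays A \<tau> p n) \<le> card (extended_plays A \<tau> p n)"
    by (rule card_extended_plays_ge) fact+
  also have "\<dots> \<le> card (avoiding_plays A \<tau> p (Suc n) \<union>
      (\<Union>e\<in>{2 * n + 1, 2 * n + 2}. \<Union>L\<in>Ls. ?D e L))"
    unfolding Ls_def using \<open>finite Ls\<close> finite_plays[OF assms(1)]
    by (intro card_mono extended_plays_subset) (auto simp: Ls_def)
  also have "\<dots> \<le> card (avoiding_plays A \<tau> p (Suc n)) + (\<Sum>e\<in>{2 * n + 1, 2 * n + 2}. \<Sum>L\<in>Ls. card (?D e L))"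
    using \<open>finite Ls\<close>
    by (intro order.trans[OF card_Un_le] add_left_mono order.trans[OF card_UN_le] sum_mono card_UN_le) auto
  finally have "card A * card (avoiding_plays A \<tau> p n)
      \<le> card (avoiding_plays A \<tau> p (Suc n)) + (\<Sum>e\<in>{2 * n + 1, 2 * n + 2}. \<Sum>L\<in>Ls. card (?D e L))" .
  then have "real (card A * card (avoiding_plays A \<tau> p n))
      \<le> real (card (avoiding_plays A \<tau> p (Suc n)) + (\<Sum>e\<in>{2 * n + 1, 2 * n + 2}. \<Sum>L\<in>Ls. card (?D e L)))"
    by (simp only: of_nat_le_iff)
  then have "2 * \<beta> * g n \<le> g (Suc n) + (\<Sum>e\<in>{2 * n + 1, 2 * n + 2}. \<Sum>L\<in>Ls. real (card (?D e L)))"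
    by (simp add: \<beta>_def g_def)
  also have "(\<Sum>e\<in>{2 * n + 1, 2 * n + 2}. \<Sum>L\<in>Ls. real (card (?D e L))) \<le> g n * \<beta> / 2 + g n * \<beta> / 2"
    using D_sum[of "2 * n + 1"] D_sum[of "2 * n + 2"] by (simp add: mult.commute[of "g n"])
  finally show ?case by (simp add: g_def \<beta>_def mult.commute)
qed

section \<open>Existence of avoiding plays and of the strategy\<close>

lemma avoiding_play_exists:
  fixes p :: "'v list"
  assumes "finite A" "28 \<le> card A" "range \<tau> \<subseteq> A" "\<nexists>x. isolated p x" "p \<noteq> []"
  shows "\<exists>h. length h = 2 * n \<and> follows2 A \<tau> h \<and> avoiding p h"
proof -
  have "0 < card (avoiding_plays A \<tau> p n)"
  proof (induction n)
    case 0
    \<comment> \<open>An occurrence has positive length, so the empty history contains none.\<close>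
    have "0 < offset L p (length p)" if "\<forall>x\<in>set p. 2 \<le> L x" for L
      using that \<open>p \<noteq> []\<close> offset_block_le[of 0 "length p" L p] by (force simp: in_set_conv_nth)
    then have "[] \<in> avoiding_plays A \<tau> p 0"
      by (fastforce simp: avoiding_plays_def follows2_def avoiding_def)
    then show ?case using finite_plays(1)[OF assms(1)] by (metis card_gt_0_iff empty_iff)
  next
    case (Suc n)
    have "0 < real (card (avoiding_plays A \<tau> p n)) * (real (card A) / 2)"
      using Suc assms(2) by simp
    then show ?case using card_avoiding_plays_Suc[OF assms, of n] by linarith
  qed
  then obtain h where "h \<in> avoiding_plays A \<tau> p n" by fastforce
  then show ?thesis by (auto simp: avoiding_plays_def)
qed

theorem theorem1p6:
  fixes A :: "'a set" and p :: "'v list"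
  assumes "card A = 429"
    and "p \<noteq> []"
    and "\<nexists>x. isolated p x"
  shows "\<exists>\<sigma>. player1_strategy A \<sigma> \<and>
    ensures A \<sigma> (\<lambda>\<alpha>. \<not> (\<exists>w Bs. contains_word \<alpha> w \<and> matches_under w p Bs \<and>
      (\<forall>i < length p. length (Bs ! i) \<ge> 2)))"
proof -
  have A: "finite A" "A \<noteq> {}" "28 \<le> card A" using assms(1) by (auto intro: card_ge_0_finite)
  obtain \<sigma> where \<sigma>: "player1_strategy A \<sigma>" "ensures A \<sigma> (\<lambda>\<alpha>. \<forall>n. avoiding p (map \<alpha> [0..<n]))"
    using closed_game_strategy[of A "avoiding p"] A avoiding_prefix[of p]
      avoiding_play_exists[OF A(1,3) _ assms(3,2)] by blast
  have "\<not> (\<exists>w Bs. contains_word \<alpha> w \<and> matches_under w p Bs \<and> (\<forall>i<length p. 2 \<le> length (Bs ! i)))"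
    if avoid: "\<And>n. avoiding p (map \<alpha> [0..<n])" for \<alpha>
  proof clarify
    fix w Bs
    assume w: "contains_word \<alpha> w" "matches_under w p Bs" "\<forall>i<length p. 2 \<le> length (Bs ! i)"
    obtain s where "w = map \<alpha> [s..<s + length w]" using w(1) unfolding contains_word_def by blast
    with w obtain L where L: "\<forall>x\<in>set p. 2 \<le> L x" "occurs_at p L s \<alpha>"
      using match_imp_occurs_at by blast
    \<comment> \<open>The prefix of \<alpha> that stops exactly where the occurrence ends.\<close>
    define n where "n = s + offset L p (length p)"
    have "occurs_at p L s ((!) (map \<alpha> [0..<n])) = occurs_at p L s \<alpha>"
      by (rule occurs_at_cong) (simp add: n_def)
    then show False using avoid[of n] L by (simp add: avoiding_def n_def)
  qed
  then show ?thesis using \<sigma> unfolding ensures_def by blast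
qed

end
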